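(* Let $q = p^s$ be a power of a prime $p$, let $m$ be a positive integer, let $Q = (q^m-1)/(q-1)$, let $N \mid q^m-1$ be such that $\gcd(Q, N) = 2^n$ for some $n \geq 1$, and let $K_Q$ be the largest odd divisor of $N$. Then $$\frac{2 q K_Q }{(q-1)\phi(K_Q)}\, Z_{q,m,N}(0) = \begin{cases} Q - 1 + (-1)^{sm}q^{m/2} & \text{if } p \equiv 1 \pmod{4};\\ Q - 1 + \left(-\sqrt{-1}\right)^{sm}q^{m/2} & \text{if } p \equiv 3 \pmod{4}. \end{cases}$$
   Context: $\phi$ is Euler's function and divisors are positive. For a positive divisor $N$ of $q^m-1$, a non-zero element $\xi \in \mathbb{F}_{q^m}^*$ is called $N$-free if, for any $d \mid N$, $\xi = \gamma^d$ with $\gamma \in \mathbb{F}_{q^m}$ implies $d=1$; equivalently $\xi = \alpha^k$ for some integer $k$ coprime to $N$, where $\alpha$ is a primitive element of $\mathbb{F}_{q^m}$. For $c \in \mathbb{F}_q$, $Z_{q,m,N}(c)$ denotes the number of $N$-free elements $\xi \in \mathbb{F}_{q^m}^*$ with $\operatorname{Tr}_{\mathbb{F}_{q^m}/\mathbb{F}_q}(\xi) = c$. *)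

theory Defs
  imports Complex_Main "HOL-Number_Theory.Number_Theory"
begin

text \<open>
  The field with \<open>q ^ m\<close> elements is a type \<open>'a\<close> of classes \<open>field\<close> and \<open>finite\<close>
  with \<open>CARD('a) = q ^ m\<close>. Its subfield with \<open>q\<close> elements is the fixed set of
  \<open>\<lambda>x. x ^ q\<close>, whose powers form the Galois group of the extension.
\<close>

definition N_free :: "nat \<Rightarrow> 'a :: field \<Rightarrow> bool" where
  "N_free N \<xi> \<longleftrightarrow> \<xi> \<noteq> 0 \<and> (\<forall>d \<gamma>. d dvd N \<and> \<xi> = \<gamma> ^ d \<longrightarrow> d = 1)"

text \<open>
  The trace from the field with \<open>q ^ m\<close> elements down to the one with \<open>q\<close> elements,
  as the sum of the conjugates of \<open>\<xi>\<close>.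
\<close>

definition field_trace :: "nat \<Rightarrow> nat \<Rightarrow> 'a :: field \<Rightarrow> 'a" where
  "field_trace q m \<xi> = (\<Sum>i<m. \<xi> ^ (q ^ i))"

definition Z_count :: "nat \<Rightarrow> nat \<Rightarrow> nat \<Rightarrow> 'a :: {field, finite} \<Rightarrow> nat" where
  "Z_count q m N c = card {\<xi> :: 'a. N_free N \<xi> \<and> field_trace q m \<xi> = c}"

definition largest_odd_divisor :: "nat \<Rightarrow> nat" where
  "largest_odd_divisor N = Max {d. d dvd N \<and> odd d}"

end

theory Submission
  imports Defs "HOL-Computational_Algebra.Polynomial"
begin

text \<open>
  Write \<open>F\<close> for the field with \<open>q\<close> elements and \<open>E\<close> for its extension of degree \<open>m\<close>. The
  count splits into a factor for the odd part \<open>K\<close> of \<open>N\<close> and a count of non-squares.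

  The quotient \<open>Q\<close> is even, because \<open>2\<close> divides \<open>gcd Q N\<close>; hence \<open>m\<close> is even when
  \<open>q\<close> is odd. An element is \<open>N\<close>-free if and only if it is a non-square and \<open>K\<close>-free. The
  elements of trace zero are permuted by multiplication with \<open>\<alpha> ^ Q\<close>, where \<open>\<alpha>\<close> is a
  primitive element, because \<open>\<alpha> ^ Q\<close> lies in \<open>F\<close>; since \<open>Q\<close> is even, the non-squares are
  permuted too. Along such orbits the exponent with respect to \<open>\<alpha>\<close> moves in steps of \<open>Q\<close>,
  which is prime to \<open>K\<close>, so the proportion of \<open>K\<close>-free elements among the non-squares of
  trace zero is exactly \<open>totient K / K\<close> (\<open>N_free_trace_zero_count\<close>).

  The number of non-squares of trace zero amounts to a quadratic Gauss sum over \<open>E\<close>. As \<open>m\<close>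
  is even, there is an intermediate field of order \<open>r = q ^ (m div 2)\<close> over which \<open>E\<close> is
  quadratic, and elementary counting suffices. Let \<open>B y\<close> be the number of non-squares whose
  trace to the intermediate field is \<open>y\<close>. The elements of trace zero are the \<open>x\<close> with
  \<open>x ^ r = - x\<close>, and by Euler's criterion the non-zero ones are all non-squares or all squares,
  which gives \<open>B 0\<close>; since all non-zero elements of the intermediate field are squares in \<open>E\<close>,
  \<open>B y\<close> is the same for all \<open>y \<noteq> 0\<close>, and the sum of all \<open>B y\<close> is half the group order.
  By transitivity of the trace, the wanted number is the sum of \<open>B y\<close> over the \<open>r / q\<close>
  elements \<open>y\<close> of trace zero in the intermediate field
  (\<open>nonsquares_of_trace_zero_even_degree\<close>).
\<close>

section \<open>Free elements as powers of a primitive element\<close>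

definition primitive_element :: "'a :: {field, finite} \<Rightarrow> bool" where
  "primitive_element \<alpha> \<longleftrightarrow>
     (\<forall>x. x \<noteq> 0 \<longrightarrow> (\<exists>a. x = \<alpha> ^ a)) \<and>
     (\<forall>a b. \<alpha> ^ a = \<alpha> ^ b \<longleftrightarrow> [a = b] (mod (card (UNIV :: 'a set) - 1)))"

lemma card_finite_field_ge_2: "card (UNIV :: 'a :: {field, finite} set) \<ge> 2"
proof -
  have "card {0, 1 :: 'a} \<le> card (UNIV :: 'a set)" by (intro card_mono) auto
  thus ?thesis by simp
qed

text \<open>
  The multiplicative group of a finite field is cyclic. A generator takes all
  \<open>card UNIV - 1\<close> non-zero values on exponents below \<open>card UNIV - 1\<close>, so it takes each of
  them once, which is why exponents matter exactly modulo \<open>card UNIV - 1\<close>.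
\<close>

lemma exists_primitive_element: "\<exists>\<alpha> :: 'a :: {field, finite}. \<alpha> \<noteq> 0 \<and> primitive_element \<alpha>"
proof -
  define R :: "'a ring" where
    "R = \<lparr>carrier = UNIV, monoid.mult = (*), one = 1, ring.zero = 0, add = (+)\<rparr>"
  have inv: "\<exists>y. x * y = 1" if "x \<noteq> 0" for x :: 'a
    by (rule exI[of _ "inverse x"]) (use that in auto)
  have add_inv: "\<exists>y. x + y = 0" for x :: 'a
    by (rule exI[of _ "- x"]) auto
  have R: "field R"
    unfolding R_def using inv add_inv by unfold_locales (auto simp: algebra_simps Units_def)
  then interpret field R .
  have pow: "x [^]\<^bsub>R\<^esub> n = x ^ n" for x :: 'a and n :: nat
    by (induction n) (auto simp: R_def)
  have carr: "carrier (mult_of R) = UNIV - {0}" "carrier R = UNIV" "\<one>\<^bsub>R\<^esub> = 1"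
    by (auto simp: R_def)
  have "finite (carrier R)" by (simp add: carr)
  from finite_field_mult_group_has_gen[OF this]
  obtain \<alpha> :: 'a where "\<alpha> \<in> UNIV - {0}" "UNIV - {0} = {\<alpha> ^ i |i::nat. i \<in> UNIV}"
    unfolding carr pow by (elim bexE) (rule that)
  hence \<alpha>: "\<alpha> \<noteq> 0" "UNIV - {0} = range (\<lambda>i::nat. \<alpha> ^ i)"
    by (auto simp: image_def)
  define M where "M = card (UNIV :: 'a set) - 1"
  have M: "M > 0" using card_finite_field_ge_2[where ?'a = 'a] by (simp add: M_def)
  have "\<alpha> [^]\<^bsub>mult_of R\<^esub> Coset.order (mult_of R) = \<one>\<^bsub>mult_of R\<^esub>"
    by (rule group.pow_order_eq_1[OF field_mult_group]) (use \<alpha> carr in auto)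
  hence one: "\<alpha> ^ M = 1"
    unfolding nat_pow_mult_of pow Coset.order_def carr one_mult_of M_def by simp
  have red: "\<alpha> ^ a = \<alpha> ^ (a mod M)" for a
  proof -
    have "\<alpha> ^ a = \<alpha> ^ (M * (a div M) + a mod M)" by simp
    also have "\<dots> = \<alpha> ^ (a mod M)" by (simp only: power_add power_mult one) simp
    finally show ?thesis .
  qed
  have "(\<lambda>i. \<alpha> ^ i) ` {..<M} = UNIV - {0}"
  proof -
    have "\<alpha> ^ i \<in> (\<lambda>i. \<alpha> ^ i) ` {..<M}" for i
      using red[of i] M by auto
    thus ?thesis using \<alpha> by auto
  qed
  hence "inj_on (\<lambda>i. \<alpha> ^ i) {..<M}"
    by (intro eq_card_imp_inj_on) (auto simp: M_def)
  hence "\<alpha> ^ a = \<alpha> ^ b \<longleftrightarrow> [a = b] (mod M)" for a b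
    using red[of a] red[of b] M by (auto simp: cong_def inj_on_def)
  hence "primitive_element \<alpha>"
    using \<alpha> unfolding primitive_element_def M_def by auto
  thus ?thesis using \<alpha> by auto
qed

lemma primitive_element_exponent:
  "primitive_element \<alpha> \<Longrightarrow> x \<noteq> 0 \<Longrightarrow> \<exists>a. x = \<alpha> ^ a"
  by (simp add: primitive_element_def)

lemma primitive_element_power_eq_iff:
  fixes \<alpha> :: "'a :: {field, finite}"
  assumes "primitive_element \<alpha>"
  shows "\<alpha> ^ a = \<alpha> ^ b \<longleftrightarrow> [a = b] (mod (card (UNIV :: 'a set) - 1))"
  using assms by (simp add: primitive_element_def)

lemma N_free_nonzero: "N_free N \<xi> \<Longrightarrow> \<xi> \<noteq> 0"
  unfolding N_free_def by blast

lemma N_freeD: "N_free N \<xi> \<Longrightarrow> d dvd N \<Longrightarrow> \<xi> = \<gamma> ^ d \<Longrightarrow> d = 1"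
  unfolding N_free_def by blast

text \<open>
  If \<open>\<alpha> ^ a\<close> is an \<open>e\<close>-th power and \<open>e\<close> divides the group order, then comparing exponents
  modulo \<open>e\<close> gives \<open>e dvd a\<close>; conversely \<open>\<alpha> ^ a\<close> is a \<open>gcd a d\<close>-th power.
\<close>

lemma N_free_power_iff:
  fixes \<alpha> :: "'a :: {field, finite}"
  assumes "\<alpha> \<noteq> 0" and prim: "primitive_element \<alpha>" and d: "d dvd card (UNIV :: 'a set) - 1"
  shows "N_free d (\<alpha> ^ a) \<longleftrightarrow> coprime a d"
proof
  assume free: "N_free d (\<alpha> ^ a)"
  have "\<alpha> ^ a = (\<alpha> ^ (a div gcd a d)) ^ gcd a d"
    by (simp only: dvd_div_mult_self gcd_dvd1 flip: power_mult)
  hence "gcd a d = 1"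
    by (rule N_freeD[OF free gcd_dvd2])
  thus "coprime a d" by (rule gcd_eq_1_imp_coprime)
next
  assume cop: "coprime a d"
  have "e = 1" if e: "e dvd d" "\<alpha> ^ a = \<gamma> ^ e" for e \<gamma>
  proof -
    have "card (UNIV :: 'a set) - 1 > 0"
      using card_finite_field_ge_2[where ?'a = 'a] by simp
    hence "e > 0" using d e(1) by (auto intro!: Nat.gr0I)
    hence "\<gamma> \<noteq> 0" using e(2) \<open>\<alpha> \<noteq> 0\<close> by (auto simp: power_0_left)
    then obtain b where "\<gamma> = \<alpha> ^ b" using primitive_element_exponent[OF prim] by blast
    hence "\<alpha> ^ a = \<alpha> ^ (b * e)" using e by (simp add: power_mult)
    hence "[a = b * e] (mod (card (UNIV :: 'a set) - 1))"
      by (simp only: primitive_element_power_eq_iff[OF prim])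
    hence "[a = b * e] (mod e)"
      by (rule cong_dvd_modulus_nat) (rule dvd_trans[OF e(1) d])
    hence "e dvd a" using cong_dvd_iff by fastforce
    thus "e = 1" using coprime_common_divisor_nat[OF cop _ e(1)] by simp
  qed
  moreover have "\<alpha> ^ a \<noteq> 0" using \<open>\<alpha> \<noteq> 0\<close> by simp
  ultimately show "N_free d (\<alpha> ^ a)" unfolding N_free_def by blast
qed

text \<open>
  Euler's criterion: in a field of odd order the \<open>2\<close>-free elements are the non-squares.
\<close>

lemma N_free_2_iff:
  fixes x :: "'a :: {field, finite}"
  assumes "even (card (UNIV :: 'a set) - 1)"
  shows "N_free 2 x \<longleftrightarrow> x \<noteq> 0 \<and> x ^ ((card (UNIV :: 'a set) - 1) div 2) \<noteq> 1"
proof (cases "x = 0")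
  case False
  define M where "M = card (UNIV :: 'a set) - 1"
  have M: "M div 2 > 0" "2 * (M div 2) = M"
    using assms card_finite_field_ge_2[where ?'a = 'a] unfolding M_def by presburger+
  obtain \<alpha> :: 'a where \<alpha>: "\<alpha> \<noteq> 0" "primitive_element \<alpha>"
    using exists_primitive_element by blast
  obtain a where a: "x = \<alpha> ^ a"
    using primitive_element_exponent[OF \<alpha>(2) False] by blast
  have "x ^ (M div 2) = 1 \<longleftrightarrow> \<alpha> ^ (a * (M div 2)) = \<alpha> ^ 0"
    by (simp add: a power_mult)
  also have "\<dots> \<longleftrightarrow> 2 * (M div 2) dvd a * (M div 2)"
    by (simp only: primitive_element_power_eq_iff[OF \<alpha>(2)] M(2) cong_0_iff flip: M_def)
  also have "\<dots> \<longleftrightarrow> even a"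
    using M(1) by (intro dvd_times_right_cancel_iff) simp
  finally have "x ^ (M div 2) = 1 \<longleftrightarrow> even a" .
  moreover have "N_free 2 x \<longleftrightarrow> odd a"
    unfolding a N_free_power_iff[OF \<alpha> assms] by simp
  ultimately show ?thesis using False by (simp add: M_def)
qed (use N_free_nonzero in blast)

text \<open>
  Multiplication by a primitive element exchanges squares and non-squares.
\<close>

lemma card_N_free_2:
  assumes "even (card (UNIV :: 'a :: {field, finite} set) - 1)"
  shows "2 * card {x :: 'a. N_free 2 x} = card (UNIV :: 'a set) - 1"
proof -
  obtain \<alpha> :: 'a where \<alpha>: "\<alpha> \<noteq> 0" "primitive_element \<alpha>"
    using exists_primitive_element by blast
  have flip: "N_free 2 (\<alpha> * x) \<longleftrightarrow> \<not> N_free 2 x" if "x \<noteq> 0" for x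
  proof -
    obtain a where a: "x = \<alpha> ^ a" using primitive_element_exponent[OF \<alpha>(2) \<open>x \<noteq> 0\<close>] by blast
    show ?thesis
      unfolding a power_Suc[symmetric] N_free_power_iff[OF \<alpha> assms] by simp
  qed
  define A B where "A = {x :: 'a. N_free 2 x}" and "B = {x :: 'a. x \<noteq> 0 \<and> \<not> N_free 2 x}"
  have "bij_betw (\<lambda>x. \<alpha> * x) B A"
  proof (rule bij_betw_byWitness[where f' = "\<lambda>x. x / \<alpha>"])
    show "(\<lambda>x. \<alpha> * x) ` B \<subseteq> A" using flip by (auto simp: A_def B_def)
    show "(\<lambda>x. x / \<alpha>) ` A \<subseteq> B"
    proof safe
      fix x assume "x \<in> A"
      hence x: "N_free 2 x" "x / \<alpha> \<noteq> 0" using \<alpha> N_free_nonzero by (auto simp: A_def)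
      moreover have "\<alpha> * (x / \<alpha>) = x" using \<alpha> by simp
      ultimately have "\<not> N_free 2 (x / \<alpha>)" using flip[OF x(2)] by simp
      thus "x / \<alpha> \<in> B" using x by (simp add: B_def)
    qed
  qed (use \<alpha> in auto)
  hence "card B = card A" by (rule bij_betw_same_card)
  moreover have "card (A \<union> B) = card A + card B"
    by (intro card_Un_disjoint) (auto simp: A_def B_def)
  moreover have "A \<union> B = UNIV - {0}"
    unfolding A_def B_def using N_free_nonzero by blast
  ultimately show ?thesis by (simp add: A_def)
qed

section \<open>Removing the odd part of the divisor\<close>

text \<open>
  Modulo \<open>K\<close> the progression with step \<open>Q\<close> runs once through all residues.
\<close>

lemma card_coprime_progression:
  fixes a Q K :: nat
  assumes "K > 0" and "coprime Q K"
  shows "card {j \<in> {..<K}. coprime (a + Q * j) K} = totient K"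
proof -
  let ?f = "\<lambda>j. (a + Q * j) mod K"
  have inj: "inj_on ?f {..<K}"
  proof (rule inj_onI)
    fix i j assume ij: "i \<in> {..<K}" "j \<in> {..<K}" "?f i = ?f j"
    hence "[Q * i = Q * j] (mod K)"
      using cong_add_lcancel_nat by (simp add: cong_def[symmetric])
    hence "[i = j] (mod K)"
      using assms cong_mult_lcancel_nat by blast
    thus "i = j" using ij by (simp add: cong_def)
  qed
  have img: "?f ` {..<K} = {..<K}"
    by (rule endo_inj_surj) (use inj \<open>K > 0\<close> in auto)
  have "bij_betw ?f {j \<in> {..<K}. coprime (a + Q * j) K} {k \<in> {..<K}. coprime k K}"
    unfolding bij_betw_def
  proof
    show "inj_on ?f {j \<in> {..<K}. coprime (a + Q * j) K}"
      by (rule inj_on_subset[OF inj]) auto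
    have "coprime (?f j) K \<longleftrightarrow> coprime (a + Q * j) K" for j
      using \<open>K > 0\<close> by (simp add: coprime_commute coprime_mod_right_iff)
    hence "{j \<in> {..<K}. coprime (a + Q * j) K} = {j \<in> {..<K}. coprime (?f j) K}" by blast
    moreover have "?f ` {j \<in> {..<K}. coprime (?f j) K} = {k \<in> ?f ` {..<K}. coprime k K}" by blast
    ultimately show "?f ` {j \<in> {..<K}. coprime (a + Q * j) K} = {k \<in> {..<K}. coprime k K}"
      using img by simp
  qed
  hence "card {j \<in> {..<K}. coprime (a + Q * j) K} = card {k \<in> {..<K}. coprime k K}"
    by (rule bij_betw_same_card)
  also have "\<dots> = totient K"
  proof (cases "K = 1")
    case False
    have "{k \<in> {..<K}. coprime k K} = totatives K"
      using False \<open>K > 0\<close> totatives_less[of _ K]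
      by (auto simp: in_totatives_iff intro!: Nat.gr0I)
    thus ?thesis by (simp add: totient_def)
  next
    case True
    hence "{k \<in> {..<K}. coprime k K} = {0}" by auto
    thus ?thesis using True by simp
  qed
  finally show ?thesis .
qed

text \<open>
  Among the non-zero elements with a property that multiplication by \<open>\<alpha> ^ Q\<close> preserves, the
  \<open>K\<close>-free ones have density \<open>totient K / K\<close>. The pairs \<open>(j, x)\<close> with \<open>j < K\<close> and
  \<open>\<alpha> ^ (Q * j) * x\<close> being \<open>K\<close>-free are counted twice. For fixed \<open>j\<close>, multiplication by
  \<open>\<alpha> ^ (Q * j)\<close> is a bijection onto the \<open>K\<close>-free elements with the property. For fixed
  \<open>x = \<alpha> ^ a\<close>, the exponents \<open>a + Q * j\<close> form a progression with step prime to \<open>K\<close>.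
\<close>

lemma card_N_free_orbit_invariant:
  fixes \<alpha> :: "'a :: {field, finite}" and P :: "'a \<Rightarrow> bool"
  assumes \<alpha>: "\<alpha> \<noteq> 0" "primitive_element \<alpha>"
    and K: "K dvd card (UNIV :: 'a set) - 1"
    and "coprime Q K"
    and inv: "\<And>x. P (\<alpha> ^ Q * x) \<longleftrightarrow> P x"
  shows "K * card {x. N_free K x \<and> P x} = totient K * card {x. x \<noteq> 0 \<and> P x}"
proof -
  define T where "T = {x. x \<noteq> 0 \<and> P x}"
  have "card (UNIV :: 'a set) - 1 > 0"
    using card_finite_field_ge_2[where ?'a = 'a] by simp
  hence "K > 0" using K by (auto intro!: Nat.gr0I)
  have inv': "P (\<alpha> ^ (Q * j) * x) \<longleftrightarrow> P x" for j x
  proof (induction j)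
    case (Suc j)
    have "\<alpha> ^ (Q * Suc j) * x = \<alpha> ^ Q * (\<alpha> ^ (Q * j) * x)"
      by (simp only: mult_Suc_right power_add mult.assoc)
    thus ?case by (simp only: inv Suc)
  qed simp
  have shift: "card {x \<in> T. N_free K (\<alpha> ^ (Q * j) * x)} = card {x. N_free K x \<and> P x}" for j
  proof (rule bij_betw_same_card)
    let ?\<beta> = "\<alpha> ^ (Q * j)"
    have \<beta>: "?\<beta> \<noteq> 0" using \<alpha> by simp
    show "bij_betw (\<lambda>x. ?\<beta> * x) {x \<in> T. N_free K (?\<beta> * x)} {x. N_free K x \<and> P x}"
    proof (rule bij_betw_byWitness[where f' = "\<lambda>x. x / ?\<beta>"])
      show "(\<lambda>x. ?\<beta> * x) ` {x \<in> T. N_free K (?\<beta> * x)} \<subseteq> {x. N_free K x \<and> P x}"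
        using inv' by (auto simp: T_def)
      show "(\<lambda>x. x / ?\<beta>) ` {x. N_free K x \<and> P x} \<subseteq> {x \<in> T. N_free K (?\<beta> * x)}"
      proof safe
        fix x assume x: "N_free K x" "P x"
        have eq: "?\<beta> * (x / ?\<beta>) = x" using \<beta> by simp
        have "P (x / ?\<beta>)" using inv'[of j "x / ?\<beta>"] x(2) unfolding eq by simp
        thus "x / ?\<beta> \<in> T" using N_free_nonzero[OF x(1)] \<beta> by (simp add: T_def)
        show "N_free K (?\<beta> * (x / ?\<beta>))" unfolding eq by (rule x(1))
      qed
    qed (use \<beta> in auto)
  qed
  have count: "card {j \<in> {..<K}. N_free K (\<alpha> ^ (Q * j) * x)} = totient K" if "x \<in> T" for x
  proof -
    obtain a where a: "x = \<alpha> ^ a"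
      using primitive_element_exponent[OF \<alpha>(2)] \<open>x \<in> T\<close> unfolding T_def by blast
    have "N_free K (\<alpha> ^ (Q * j) * x) \<longleftrightarrow> coprime (a + Q * j) K" for j
      unfolding a power_add[symmetric] N_free_power_iff[OF \<alpha> K] by (simp add: add.commute)
    thus ?thesis
      using card_coprime_progression[OF \<open>K > 0\<close> \<open>coprime Q K\<close>, of a] by simp
  qed
  have "(\<Sum>j<K. card {x \<in> T. N_free K (\<alpha> ^ (Q * j) * x)}) = totient K * card T"
    by (rule sum_multicount) (use count in auto)
  thus ?thesis unfolding shift by (simp add: T_def)
qed

section \<open>Fibres of additive maps and of the trace\<close>

lemma card_eq_sum_card_fibres:
  assumes "finite S" and "finite T" and "g ` S \<subseteq> T"
  shows "card S = (\<Sum>y\<in>T. card {x \<in> S. g x = y})"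
  using sum.group[OF assms, of "\<lambda>_. 1 :: nat"] by simp

lemma card_fibre_additive:
  fixes f :: "'a :: {ab_group_add, finite} \<Rightarrow> 'b :: ab_group_add"
  assumes add: "\<And>x y. f (x + y) = f x + f y"
  shows "card {x. f x = f z} = card {x. f x = 0}"
proof (rule bij_betw_same_card)
  have "f (x - z) = f x - f z" for x using add[of "x - z" z] by simp
  thus "bij_betw (\<lambda>x. x - z) {x. f x = f z} {x. f x = 0}"
    by (intro bij_betw_byWitness[where f' = "\<lambda>x. x + z"]) (auto simp: add)
qed

lemma card_range_times_card_kernel:
  fixes f :: "'a :: {ab_group_add, finite} \<Rightarrow> 'b :: ab_group_add"
  assumes add: "\<And>x y. f (x + y) = f x + f y"
  shows "card (UNIV :: 'a set) = card (range f) * card {x. f x = 0}"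
proof -
  have "card (UNIV :: 'a set) = (\<Sum>y\<in>range f. card {x. f x = y})"
    using card_eq_sum_card_fibres[of UNIV "range f" f] by simp
  also have "\<dots> = (\<Sum>y\<in>range f. card {x. f x = 0})"
    by (intro sum.cong refl) (auto simp: card_fibre_additive[OF add])
  finally show ?thesis by simp
qed

lemma power_card_eq_self:
  fixes x :: "'a :: {field, finite}"
  shows "x ^ card (UNIV :: 'a set) = x"
proof (cases "x = 0")
  case False
  obtain \<alpha> :: 'a where \<alpha>: "\<alpha> \<noteq> 0" "primitive_element \<alpha>"
    using exists_primitive_element by blast
  obtain a where a: "x = \<alpha> ^ a"
    using primitive_element_exponent[OF \<alpha>(2) False] by blast
  define M where "M = card (UNIV :: 'a set) - 1"
  have M: "card (UNIV :: 'a set) = M + 1"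
    using card_finite_field_ge_2[where ?'a = 'a] by (simp add: M_def)
  have "[a * (M + 1) = a] (mod M)" by (simp add: cong_def)
  hence "\<alpha> ^ (a * (M + 1)) = \<alpha> ^ a"
    unfolding primitive_element_power_eq_iff[OF \<alpha>(2)] M_def .
  thus ?thesis by (simp only: M a power_mult)
qed (use card_finite_field_ge_2[where ?'a = 'a] in simp)

lemma char_eq_of_card:
  assumes "prime p" and "card (UNIV :: 'a :: {field, finite} set) = p ^ k"
  shows "CHAR('a) = p"
proof -
  have "prime CHAR('a)"
    by (intro prime_CHAR_semidom finite_imp_CHAR_pos) simp
  moreover have "CHAR('a) dvd p ^ k"
    using CHAR_dvd_CARD[where ?'a = 'a] assms(2) by simp
  ultimately show ?thesis
    using \<open>prime p\<close> by (metis prime_dvd_power primes_dvd_imp_eq)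
qed

lemma Frobenius_add:
  fixes x y :: "'a :: {field, finite}"
  assumes "prime p" and "card (UNIV :: 'a set) = p ^ k"
  shows "(x + y) ^ (p ^ j) = x ^ (p ^ j) + y ^ (p ^ j)"
  using char_eq_of_card[OF assms] \<open>prime p\<close> by (intro freshmans_dream'[of _ j]) auto

text \<open>
  The extension of degree \<open>m\<close> over the field with \<open>q\<close> elements, with the top field as a type.
  The parameter \<open>ty\<close> only names this type, so that the same type can be viewed at once as an
  extension of degree \<open>2 * h\<close> of its subfield of order \<open>q\<close> and as a quadratic extension of
  its subfield of order \<open>q ^ h\<close>.
\<close>

locale trace_extension =
  fixes ty :: "'a :: {field, finite} itself" and p s q m :: nat
  assumes p: "prime p" and s: "s \<ge> 1" and q: "q = p ^ s" and m: "m \<ge> 1"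
    and card_field: "card (UNIV :: 'a set) = q ^ m"
begin

lemma q_ge_2: "q \<ge> 2"
proof -
  have "p ^ 1 \<le> p ^ s" using s prime_gt_0_nat[OF p] by (intro power_increasing) auto
  thus ?thesis using q prime_ge_2_nat[OF p] by simp
qed

lemma Frobenius: "(x + y :: 'a) ^ (q ^ i) = x ^ (q ^ i) + y ^ (q ^ i)"
  using Frobenius_add[OF p, where ?'a = 'a, of "s * m" x y "s * i"] card_field
  by (simp add: q power_mult)

lemma trace_add: "field_trace q m (x + y :: 'a) = field_trace q m x + field_trace q m y"
  by (simp add: field_trace_def Frobenius sum.distrib)

lemma trace_scale:
  fixes c x :: 'a
  assumes "c ^ q = c"
  shows "field_trace q m (c * x) = c * field_trace q m x"
proof -
  have "c ^ (q ^ i) = c" for i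
    by (induction i) (simp_all add: power_mult assms)
  thus ?thesis by (simp add: field_trace_def power_mult_distrib sum_distrib_left)
qed

text \<open>
  Raising to the power \<open>q\<close> permutes the conjugates of \<open>x\<close> cyclically, as \<open>x ^ (q ^ m) = x\<close>.
\<close>

lemma trace_in_subfield: "(field_trace q m (x :: 'a)) ^ q = field_trace q m x"
proof -
  have "prime CHAR('a)" "q = CHAR('a) ^ s"
    using char_eq_of_card[OF p, where ?'a = 'a, of "s * m"] card_field p q
    by (simp_all add: power_mult)
  hence "(field_trace q m x) ^ q = (\<Sum>i<m. (x ^ (q ^ i)) ^ q)"
    unfolding field_trace_def by (rule freshmans_dream_sum')
  also have "\<dots> = (\<Sum>i<m. x ^ (q ^ Suc i))" by (simp add: mult.commute flip: power_mult)
  also have "\<dots> = (\<Sum>i<Suc m. x ^ (q ^ i)) - x" unfolding sum.lessThan_Suc_shift by simp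
  also have "\<dots> = field_trace q m x"
    using power_card_eq_self[of x] card_field by (simp add: field_trace_def)
  finally show ?thesis .
qed

lemma card_subfield_le: "card {x :: 'a. x ^ q = x} \<le> q"
proof -
  define P :: "'a poly" where "P = monom 1 q - monom 1 1"
  have "coeff P q = 1" using q_ge_2 by (simp add: P_def)
  hence "P \<noteq> 0" by auto
  have "{x :: 'a. x ^ q = x} = {x. poly P x = 0}" by (auto simp: P_def poly_monom)
  also have "card \<dots> \<le> degree P" by (rule card_poly_roots_bound) fact
  also have "degree P \<le> q"
    unfolding P_def using q_ge_2 by (intro degree_diff_le) (simp_all add: degree_monom_eq)
  finally show ?thesis .
qed

lemma card_trace_kernel_le: "card {x :: 'a. field_trace q m x = 0} \<le> q ^ (m - 1)"
proof -
  define P :: "'a poly" where "P = (\<Sum>i<m. monom 1 (q ^ i))"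
  have "coeff P (q ^ (m - 1)) = (\<Sum>i<m. if i = m - 1 then 1 else 0)"
    using q_ge_2 by (simp add: P_def coeff_sum)
  also have "\<dots> = 1" using m by simp
  finally have "P \<noteq> 0" by auto
  have "{x :: 'a. field_trace q m x = 0} = {x. poly P x = 0}"
    by (simp add: P_def field_trace_def poly_sum poly_monom)
  also have "card \<dots> \<le> degree P" by (rule card_poly_roots_bound) fact
  also have "degree P \<le> q ^ (m - 1)"
    unfolding P_def using q_ge_2
    by (intro degree_sum_le) (auto simp: degree_monom_eq intro!: power_increasing)
  finally show ?thesis .
qed

text \<open>
  Kernel and image of the trace are bounded by the degrees of the polynomials whose roots
  contain them, \<open>q ^ (m - 1)\<close> for the kernel and \<open>q\<close> for the fixed field that contains the
  image. The product of their sizes is \<open>q ^ m\<close>, the product of the two bounds, so both bounds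
  are attained. This also yields the order of the fixed field.
\<close>

lemma card_trace_kernel: "card {x :: 'a. field_trace q m x = 0} = q ^ (m - 1)"
  and card_subfield: "card {x :: 'a. x ^ q = x} = q"
  and range_trace: "range (field_trace q m) = {x :: 'a. x ^ q = x}"
proof -
  let ?ker = "{x :: 'a. field_trace q m x = 0}" and ?F = "{x :: 'a. x ^ q = x}"
  let ?im = "range (field_trace q m :: 'a \<Rightarrow> 'a)"
  have sub: "?im \<subseteq> ?F" using trace_in_subfield by auto
  have im_le: "card ?im \<le> card ?F" by (rule card_mono) (use sub in auto)
  have "card ?im * card ?ker = q ^ m"
    using card_range_times_card_kernel[of "field_trace q m :: 'a \<Rightarrow> 'a"] trace_add card_field
    by simp
  also have "q ^ m = q * q ^ (m - 1)" using m by (simp flip: power_Suc)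
  finally have prod: "card ?im * card ?ker = q * q ^ (m - 1)" .
  have pos: "q > 0" "q ^ (m - 1) > 0" using q_ge_2 by simp_all
  have "q * q ^ (m - 1) \<le> card ?im * q ^ (m - 1)"
    unfolding prod[symmetric] by (intro mult_left_mono card_trace_kernel_le) simp
  hence "q \<le> card ?im" using pos by simp
  hence eq: "card ?im = q" "card ?F = q" using im_le card_subfield_le by linarith+
  show "card ?F = q" by (rule eq)
  show "card ?ker = q ^ (m - 1)" using prod eq(1) pos by simp
  show "?im = ?F" by (rule card_subset_eq) (use sub eq in auto)
qed

end

section \<open>Non-squares with given trace in a quadratic extension\<close>

lemma (in trace_extension) minus_one_neq_one:
  assumes "odd q"
  shows "(-1 :: 'a) \<noteq> 1"
proof
  assume "(-1 :: 'a) = 1"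
  hence "(of_nat 2 :: 'a) = 0" by (simp add: eq_neg_iff_add_eq_0[of 1 1, symmetric])
  hence "CHAR('a) dvd 2" by (simp only: of_nat_eq_0_iff_char_dvd)
  moreover have "CHAR('a) = p"
    using char_eq_of_card[OF p, where ?'a = 'a, of "s * m"] card_field q by (simp add: power_mult)
  ultimately have "p = 2" using p by (metis primes_dvd_imp_eq two_is_prime_nat)
  thus False using \<open>odd q\<close> q s by simp
qed

locale odd_quadratic_extension = trace_extension ty p s q 2
  for ty :: "'a :: {field, finite} itself" and p s q +
  assumes odd_q: "odd q"
begin

lemma group_order: "card (UNIV :: 'a set) - 1 = (q - 1) * (q + 1)"
  unfolding card_field by (simp add: power2_eq_square algebra_simps)

lemma even_group_order: "even (card (UNIV :: 'a set) - 1)"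
  using odd_q unfolding group_order by simp

lemma nonsquare_iff:
  fixes x :: 'a
  shows "N_free 2 x \<longleftrightarrow> x \<noteq> 0 \<and> (x ^ (q - 1)) ^ ((q + 1) div 2) \<noteq> 1"
proof -
  have "(q - 1) * (q + 1) div 2 = (q - 1) * ((q + 1) div 2)"
    using odd_q by (intro div_mult_swap[symmetric]) simp
  thus ?thesis
    unfolding N_free_2_iff[OF even_group_order] group_order by (simp only: power_mult)
qed

lemma trace_eq: "field_trace q 2 (x :: 'a) = x + x ^ q"
  by (simp add: field_trace_def numeral_2_eq_2)

lemma power_pred: "x \<noteq> 0 \<Longrightarrow> x ^ (q - 1) = x ^ q / (x :: 'a)"
  using q_ge_2 by (simp add: power_diff)

text \<open>
  The non-zero \<open>x\<close> of trace zero satisfy \<open>x ^ (q - 1) = -1\<close>, so Euler's criterion evaluates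
  to \<open>(-1) ^ ((q + 1) div 2)\<close> on all of them: they are all non-squares or all squares,
  according to \<open>q\<close> modulo \<open>4\<close>.
\<close>

lemma nonsquares_of_trace_zero:
  "Z_count q 2 2 (0 :: 'a) = (if q mod 4 = 1 then q - 1 else 0)"
proof -
  have key: "N_free 2 x \<longleftrightarrow> q mod 4 = 1" if "x \<noteq> 0" "field_trace q 2 x = 0" for x :: 'a
  proof -
    have "x ^ q = - x" using that(2) by (simp add: trace_eq eq_neg_iff_add_eq_0 add.commute)
    hence "x ^ (q - 1) = -1" using power_pred[OF that(1)] that(1) by simp
    hence "N_free 2 x \<longleftrightarrow> (-1 :: 'a) ^ ((q + 1) div 2) \<noteq> 1" using that(1) by (simp add: nonsquare_iff)
    also have "\<dots> \<longleftrightarrow> odd ((q + 1) div 2)"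
      using minus_one_neq_one[OF odd_q] by (auto simp: minus_one_power_iff)
    also have "\<dots> \<longleftrightarrow> q mod 4 = 1" using odd_q by presburger
    finally show ?thesis .
  qed
  have "{x :: 'a. N_free 2 x \<and> field_trace q 2 x = 0} =
        (if q mod 4 = 1 then {x. field_trace q 2 x = 0} - {0} else {})"
    using key N_free_nonzero by auto
  moreover have "field_trace q 2 (0 :: 'a) = 0" using q_ge_2 by (simp add: trace_eq)
  ultimately show ?thesis
    unfolding Z_count_def using card_trace_kernel by simp
qed

text \<open>
  Every non-zero element of the small field is a square in the quadratic extension, so that
  scaling by it preserves non-squares while it multiplies the trace.
\<close>

lemma nonsquares_of_trace_scale:
  fixes y :: 'a
  assumes "y \<noteq> 0" and "y ^ q = y"
  shows "Z_count q 2 2 y = Z_count q 2 2 (1 :: 'a)"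
proof -
  have "y ^ (q - 1) = 1" using power_pred[OF assms(1)] assms by simp
  hence free: "N_free 2 (y * x) \<longleftrightarrow> N_free 2 x" for x
    using \<open>y \<noteq> 0\<close> by (simp add: nonsquare_iff power_mult_distrib)
  have "bij_betw (\<lambda>x. y * x) {x. N_free 2 x \<and> field_trace q 2 x = 1}
          {x. N_free 2 x \<and> field_trace q 2 x = y}"
  proof (rule bij_betw_byWitness[where f' = "\<lambda>x. x / y"])
    show "(\<lambda>x. y * x) ` {x. N_free 2 x \<and> field_trace q 2 x = 1}
          \<subseteq> {x. N_free 2 x \<and> field_trace q 2 x = y}"
      using free trace_scale[OF assms(2)] by auto
    show "(\<lambda>x. x / y) ` {x. N_free 2 x \<and> field_trace q 2 x = y}
          \<subseteq> {x. N_free 2 x \<and> field_trace q 2 x = 1}"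
    proof (intro subsetI, elim imageE)
      fix z x assume z: "z = x / y" and "x \<in> {x. N_free 2 x \<and> field_trace q 2 x = y}"
      hence x: "N_free 2 x" "field_trace q 2 x = y" by auto
      have eq: "y * (x / y) = x" using \<open>y \<noteq> 0\<close> by simp
      have "N_free 2 (x / y)" using free[of "x / y"] x(1) unfolding eq by simp
      have "y * field_trace q 2 (x / y) = y * 1"
        using trace_scale[OF assms(2), of "x / y"] x(2) unfolding eq by simp
      hence "field_trace q 2 (x / y) = 1" using \<open>y \<noteq> 0\<close> by (simp only: mult_cancel_left) simp
      with \<open>N_free 2 (x / y)\<close> show "z \<in> {x. N_free 2 x \<and> field_trace q 2 x = 1}" by (simp add: z)
    qed
  qed (use \<open>y \<noteq> 0\<close> in auto)
  thus ?thesis unfolding Z_count_def by (rule bij_betw_same_card[symmetric])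
qed

lemma sum_nonsquares_over_subfield:
  fixes W :: "'a set"
  assumes "W \<subseteq> {y. y ^ q = y}" and "0 \<in> W"
  shows "(\<Sum>y\<in>W. Z_count q 2 2 y) = Z_count q 2 2 (0 :: 'a) + (card W - 1) * Z_count q 2 2 (1 :: 'a)"
proof -
  have "(\<Sum>y\<in>W. Z_count q 2 2 y) = Z_count q 2 2 (0 :: 'a) + (\<Sum>y\<in>W - {0}. Z_count q 2 2 y)"
    using assms(2) by (intro sum.remove) auto
  also have "(\<Sum>y\<in>W - {0}. Z_count q 2 2 y) = (\<Sum>y\<in>W - {0}. Z_count q 2 2 (1 :: 'a))"
    using assms(1) by (intro sum.cong refl nonsquares_of_trace_scale) auto
  finally show ?thesis using assms(2) by simp
qed

text \<open>
  Half of the non-zero elements are non-squares. Sorting them by trace, with the numbers for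
  trace zero known and those for all other traces equal, leaves one equation for the latter.
\<close>

lemma nonsquares_of_trace_one:
  "2 * Z_count q 2 2 (1 :: 'a) = (if q mod 4 = 1 then q - 1 else q + 1)"
proof -
  let ?F = "{y :: 'a. y ^ q = y}"
  have "card {x :: 'a. N_free 2 x} = (\<Sum>y\<in>?F. Z_count q 2 2 y)"
    using card_eq_sum_card_fibres[of "{x :: 'a. N_free 2 x}" ?F "field_trace q 2"] trace_in_subfield
    by (simp add: Z_count_def image_subset_iff)
  also have "\<dots> = Z_count q 2 2 (0 :: 'a) + (q - 1) * Z_count q 2 2 (1 :: 'a)"
    using q_ge_2 by (subst sum_nonsquares_over_subfield) (auto simp: card_subfield)
  finally have "(q - 1) * (q + 1) =
      2 * Z_count q 2 2 (0 :: 'a) + (q - 1) * (2 * Z_count q 2 2 (1 :: 'a))"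
    using card_N_free_2[OF even_group_order] unfolding group_order by (simp add: algebra_simps)
  also have "2 * Z_count q 2 2 (0 :: 'a) = (q - 1) * (if q mod 4 = 1 then 2 else 0)"
    by (simp add: nonsquares_of_trace_zero)
  finally have "(q - 1) * (q + 1) =
      (q - 1) * ((if q mod 4 = 1 then 2 else 0) + 2 * Z_count q 2 2 (1 :: 'a))"
    by (simp only: distrib_left)
  hence "q + 1 = (if q mod 4 = 1 then 2 else 0) + 2 * Z_count q 2 2 (1 :: 'a)"
    using q_ge_2 by (simp only: mult_cancel_left) simp
  thus ?thesis by (auto split: if_splits)
qed

end

section \<open>Non-squares of trace zero in even degree\<close>

lemma field_trace_trans:
  fixes x :: "'a :: {field, finite}"
  assumes "\<And>x y :: 'a. \<And>i. (x + y) ^ (q ^ i) = x ^ (q ^ i) + y ^ (q ^ i)"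
  shows "field_trace q (2 * h) x = field_trace q h (field_trace (q ^ h) 2 x)"
proof -
  have "field_trace q (2 * h) x = (\<Sum>i<h + h. x ^ (q ^ i))"
    by (simp add: field_trace_def mult_2)
  also have "\<dots> = (\<Sum>i<h. x ^ (q ^ i)) + (\<Sum>i<h. x ^ (q ^ (h + i)))"
    by (simp add: lessThan_atLeast0 sum.atLeastLessThan_concat[of 0 h "h + h", symmetric]
          sum.atLeastLessThan_shift_0[of _ h "h + h"])
  also have "\<dots> = (\<Sum>i<h. (x + x ^ (q ^ h)) ^ (q ^ i))"
    by (simp add: assms sum.distrib power_add power_mult)
  also have "\<dots> = field_trace q h (field_trace (q ^ h) 2 x)"
    by (simp add: field_trace_def numeral_2_eq_2)
  finally show ?thesis .
qed

text \<open>
  By transitivity of the trace, an element has trace zero over the field of order \<open>q\<close> exactly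
  when its trace to the intermediate field of order \<open>r\<close> lies in the kernel \<open>W\<close> of the trace
  from there. The number of non-squares is therefore a sum over \<open>W\<close> of the counts in the
  quadratic extension, in which \<open>0\<close> contributes its own count and every other element of
  \<open>W\<close> the count for trace one. The size \<open>r / q\<close> of \<open>W\<close> results from applying the same
  decomposition to all elements of trace zero, as each fibre of the inner trace has \<open>r\<close> elements.
\<close>

lemma nonsquares_of_trace_zero_even_degree:
  fixes p s q h :: nat
  assumes "trace_extension TYPE('a :: {field, finite}) p s q (2 * h)" and "odd q" and "h \<ge> 1"
  defines "r \<equiv> q ^ h"
  shows "2 * q * Z_count q (2 * h) 2 (0 :: 'a) =
    (if r mod 4 = 1 then (r - 1) * (r + q) else (r - q) * (r + 1))"
proof -
  interpret big: trace_extension "TYPE('a)" p s q "2 * h" by fact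
  \<comment> \<open>Unqualified facts are those of the quadratic extension, with \<open>r\<close> in the role of \<open>q\<close>.\<close>
  interpret odd_quadratic_extension "TYPE('a)" p "s * h" r
    using big.p big.s big.q big.card_field assms(2,3)
    by unfold_locales (auto simp: r_def power_mult mult.commute[of 2 h])
  have trans: "field_trace q (2 * h) x = field_trace q h (field_trace r 2 x)" for x :: 'a
    unfolding r_def by (rule field_trace_trans) (rule big.Frobenius)
  define W where "W = {y :: 'a. y ^ r = y \<and> field_trace q h y = 0}"
  have W: "W \<subseteq> {y. y ^ r = y}" "0 \<in> W"
    using q_ge_2 big.q_ge_2 by (auto simp: W_def field_trace_def power_0_left)
  have "q ^ (2 * h - 1) = card {x :: 'a. field_trace q (2 * h) x = 0}"
    by (simp add: big.card_trace_kernel)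
  also have "\<dots> = (\<Sum>y\<in>W. card {x \<in> {x :: 'a. field_trace q (2 * h) x = 0}. field_trace r 2 x = y})"
    by (rule card_eq_sum_card_fibres) (use trans trace_in_subfield in \<open>auto simp: W_def\<close>)
  also have "\<dots> = (\<Sum>y\<in>W. r)"
  proof (rule sum.cong[OF refl])
    fix y assume y: "y \<in> W"
    then obtain z where z: "y = field_trace r 2 z" using range_trace W(1) by blast
    have "{x \<in> {x :: 'a. field_trace q (2 * h) x = 0}. field_trace r 2 x = y} =
          {x. field_trace r 2 x = field_trace r 2 z}"
      using y trans z by (auto simp: W_def)
    thus "card {x \<in> {x :: 'a. field_trace q (2 * h) x = 0}. field_trace r 2 x = y} = r"
      using card_fibre_additive[of "field_trace r 2 :: 'a \<Rightarrow> 'a", OF trace_add] card_trace_kernel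
      by simp
  qed
  finally have "q * q ^ (2 * h - 1) = q * (card W * r)" by simp
  moreover have "q * q ^ (2 * h - 1) = r * r"
    using assms(3) by (simp add: r_def mult_2 flip: power_Suc power_add)
  ultimately have "(q * card W) * r = r * r" by (simp only: mult.assoc)
  hence cardW: "q * card W = r" using q_ge_2 by (simp only: mult_cancel2) simp
  have "Z_count q (2 * h) 2 (0 :: 'a) = (\<Sum>y\<in>W. card {x \<in> {x :: 'a. N_free 2 x \<and> field_trace q (2 * h) x = 0}. field_trace r 2 x = y})"
    unfolding Z_count_def
    by (rule card_eq_sum_card_fibres) (use trans trace_in_subfield in \<open>auto simp: W_def\<close>)
  also have "\<dots> = (\<Sum>y\<in>W. Z_count r 2 2 y)"
    unfolding Z_count_def
    by (intro sum.cong refl arg_cong[of _ _ card]) (auto simp: W_def trans)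
  also have "\<dots> = Z_count r 2 2 (0 :: 'a) + (card W - 1) * Z_count r 2 2 (1 :: 'a)"
    by (rule sum_nonsquares_over_subfield[OF W])
  finally have "2 * q * Z_count q (2 * h) 2 (0 :: 'a) =
      2 * q * Z_count r 2 2 (0 :: 'a) + (q * card W - q) * (2 * Z_count r 2 2 (1 :: 'a))"
    by (simp add: algebra_simps)
  also have "\<dots> = (if r mod 4 = 1 then 2 * q * (r - 1) + (r - q) * (r - 1) else (r - q) * (r + 1))"
    unfolding cardW nonsquares_of_trace_one nonsquares_of_trace_zero by simp
  also have "2 * q * (r - 1) + (r - q) * (r - 1) = (r - 1) * (r + q)"
  proof -
    have "q \<le> r" using cardW W(2) q_ge_2 by (cases "card W") auto
    hence "2 * q + (r - q) = r + q" by simp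
    thus ?thesis by (metis add_mult_distrib mult.commute)
  qed
  finally show ?thesis .
qed

section \<open>The count of free elements of trace zero\<close>

lemma largest_odd_divisor_decomposition:
  assumes "N > 0"
  shows "odd (largest_odd_divisor N)" and "\<exists>k. N = 2 ^ k * largest_odd_divisor N"
proof -
  obtain o' where o: "N = 2 ^ multiplicity 2 N * o'" "\<not> 2 dvd o'"
    using multiplicity_decompose'[of N 2] assms by auto
  have "Max {d. d dvd N \<and> odd d} = o'"
  proof (rule Max_eqI)
    show "finite {d. d dvd N \<and> odd d}"
      by (rule finite_subset[of _ "{..N}"]) (use assms dvd_imp_le in auto)
    show "o' \<in> {d. d dvd N \<and> odd d}" using o by (metis dvd_triv_right mem_Collect_eq)
    fix d assume d: "d \<in> {d. d dvd N \<and> odd d}"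
    hence "coprime d (2 ^ multiplicity 2 N)" by simp
    hence "d dvd o'" using d o(1) by (metis coprime_dvd_mult_right_iff mem_Collect_eq)
    moreover have "o' > 0" using o assms by (auto intro!: Nat.gr0I)
    ultimately show "d \<le> o'" by (rule dvd_imp_le)
  qed
  thus "odd (largest_odd_divisor N)" "\<exists>k. N = 2 ^ k * largest_odd_divisor N"
    using o unfolding largest_odd_divisor_def by auto
qed

lemma geometric_sum_nat:
  fixes q m :: nat
  assumes "q \<ge> 1"
  shows "q ^ m - 1 = (q - 1) * (\<Sum>i<m. q ^ i)"
proof -
  obtain k where k: "q = Suc k" using assms by (cases q) auto
  have "q ^ m = k * (\<Sum>i<m. q ^ i) + 1"
    by (induction m) (simp_all add: k algebra_simps)
  thus ?thesis by (simp add: k)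
qed

text \<open>
  Since \<open>N\<close> is even, being \<open>N\<close>-free splits into being a non-square and being \<open>K\<close>-free.
  The element \<open>\<alpha> ^ Q\<close> lies in the field of order \<open>q\<close>, and it is a square because \<open>Q\<close> is
  even; hence multiplication by it preserves both trace zero and non-squares, and as
  \<open>Q\<close> is prime to \<open>K\<close> the \<open>K\<close>-free part can be averaged out.
\<close>

lemma (in trace_extension) N_free_trace_zero_count:
  assumes Q: "Q = (q ^ m - 1) div (q - 1)" and N: "N dvd q ^ m - 1"
    and n: "n \<ge> 1" and gcd: "gcd Q N = 2 ^ n" and K: "K = largest_odd_divisor N"
  shows "K * Z_count q m N (0 :: 'a) = totient K * Z_count q m 2 (0 :: 'a)"
proof -
  let ?M = "card (UNIV :: 'a set) - 1"
  have M: "?M = q ^ m - 1" by (simp add: card_field)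
  have "?M > 0" using card_finite_field_ge_2[where ?'a = 'a] by simp
  hence "N > 0" using N unfolding M by (auto intro!: Nat.gr0I)
  obtain k where k: "N = 2 ^ k * K" and "odd K"
    using largest_odd_divisor_decomposition[OF \<open>N > 0\<close>] K by blast
  have "2 dvd gcd Q N" using n gcd by simp
  hence "even Q" "even N" by auto
  hence "k \<noteq> 0" using k \<open>odd K\<close> by (auto intro!: Nat.gr0I)
  have "K dvd N" using k by simp
  have "coprime Q K"
  proof (rule coprimeI)
    fix d assume d: "d dvd Q" "d dvd K"
    hence "d dvd 2 ^ n" using \<open>K dvd N\<close> gcd by (metis dvd_trans gcd_greatest)
    moreover have "coprime d (2 ^ n)" using d(2) \<open>odd K\<close> by (auto dest: dvd_trans)
    ultimately show "is_unit d" using coprime_absorb_left by blast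
  qed
  obtain \<alpha> :: 'a where \<alpha>: "\<alpha> \<noteq> 0" "primitive_element \<alpha>"
    using exists_primitive_element by blast
  have QM: "Q * (q - 1) = ?M"
    unfolding Q M using geometric_sum_nat[of q m] q_ge_2 by simp
  have NM: "N dvd ?M" "2 dvd ?M" "K dvd ?M"
    using N \<open>even N\<close> \<open>K dvd N\<close> unfolding M by (blast intro: dvd_trans)+
  have free: "N_free N x \<longleftrightarrow> N_free K x \<and> N_free 2 x" for x :: 'a
  proof (cases "x = 0")
    case False
    obtain a where a: "x = \<alpha> ^ a"
      using primitive_element_exponent[OF \<alpha>(2) False] by blast
    have "coprime a N \<longleftrightarrow> coprime a K \<and> coprime a 2"
      unfolding k using \<open>k \<noteq> 0\<close> by (auto simp: coprime_power_right_iff)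
    thus ?thesis
      unfolding a N_free_power_iff[OF \<alpha> NM(1)] N_free_power_iff[OF \<alpha> NM(2)]
        N_free_power_iff[OF \<alpha> NM(3)] .
  qed (use N_free_nonzero in blast)
  define P where "P = (\<lambda>x :: 'a. N_free 2 x \<and> field_trace q m x = 0)"
  have "P (\<alpha> ^ Q * x) \<longleftrightarrow> P x" for x
  proof (cases "x = 0")
    case False
    obtain a where a: "x = \<alpha> ^ a"
      using primitive_element_exponent[OF \<alpha>(2) False] by blast
    have "[Q * q = Q] (mod ?M)"
    proof -
      have "Q * q = Q + Q * (q - 1)" using q_ge_2 by (simp add: algebra_simps)
      thus ?thesis by (simp only: QM cong_def mod_add_self2)
    qed
    hence "(\<alpha> ^ Q) ^ q = \<alpha> ^ Q"
      by (simp only: primitive_element_power_eq_iff[OF \<alpha>(2)] flip: power_mult)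
    hence "field_trace q m (\<alpha> ^ Q * x) = \<alpha> ^ Q * field_trace q m x" by (rule trace_scale)
    moreover have "N_free 2 (\<alpha> ^ Q * x) \<longleftrightarrow> N_free 2 x"
      unfolding a power_add[symmetric] N_free_power_iff[OF \<alpha> NM(2)] using \<open>even Q\<close> by simp
    ultimately show ?thesis using \<alpha>(1) by (simp add: P_def)
  qed simp
  from card_N_free_orbit_invariant[OF \<alpha> NM(3) \<open>coprime Q K\<close>, where P = P, OF this]
  have "K * card {x. N_free K x \<and> P x} = totient K * card {x. x \<noteq> 0 \<and> P x}" .
  moreover have "{x. N_free K x \<and> P x} = {x. N_free N x \<and> field_trace q m x = 0}"
    using free by (auto simp: P_def)
  moreover have "{x. x \<noteq> 0 \<and> P x} = {x. N_free 2 x \<and> field_trace q m x = 0}"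
    using N_free_nonzero by (auto simp: P_def)
  ultimately show ?thesis by (simp only: Z_count_def)
qed

lemma even_degree_of_even_quotient:
  fixes q m :: nat
  assumes "q \<ge> 2" and "odd q" and "even ((q ^ m - 1) div (q - 1))"
  shows "even m"
proof -
  have "(q ^ m - 1) div (q - 1) = (\<Sum>i<m. q ^ i)"
    using assms(1) geometric_sum_nat[of q m] by simp
  moreover have "even (\<Sum>i<m. q ^ i) \<longleftrightarrow> even m"
    using assms(2) by (induction m) auto
  ultimately show ?thesis using assms(3) by simp
qed

lemma mod_4_power:
  fixes p t :: nat
  shows "p mod 4 = 1 \<Longrightarrow> p ^ t mod 4 = 1"
    and "p mod 4 = 3 \<Longrightarrow> p ^ t mod 4 = (if even t then 1 else 3)"
proof (induction t)
  case (Suc t)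
  {
    case 1
    have "p ^ Suc t mod 4 = ((p mod 4) * (p ^ t mod 4)) mod 4" by (simp add: mod_mult_eq)
    thus ?case using 1 Suc(1) by simp
  next
    case 2
    have "p ^ Suc t mod 4 = ((p mod 4) * (p ^ t mod 4)) mod 4" by (simp add: mod_mult_eq)
    thus ?case using 2 Suc(2) by simp
  }
qed auto

text \<open>
  For odd \<open>p\<close> the previous counts combine to the formula with sign \<open>\<epsilon>\<close>, which is \<open>1\<close> if
  \<open>r = q ^ (m div 2)\<close> is congruent to \<open>1\<close> modulo \<open>4\<close> and \<open>-1\<close> otherwise. As \<open>m\<close> is even,
  so is \<open>s * m\<close>, and both \<open>(-1) ^ (s * m)\<close> for \<open>p mod 4 = 1\<close> and \<open>(-\<i>) ^ (s * m)\<close> for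
  \<open>p mod 4 = 3\<close> reduce to \<open>\<epsilon>\<close>.
\<close>

theorem corollary1p6:
  fixes p s q m N n Q K :: nat
  assumes "prime p" and "s \<ge> 1" and "q = p ^ s"
    and "m \<ge> 1"
    and "card (UNIV :: 'a :: {field, finite} set) = q ^ m"
    and "Q = (q ^ m - 1) div (q - 1)"
    and "N dvd q ^ m - 1"
    and "n \<ge> 1" and "gcd Q N = 2 ^ n"
    and "K = largest_odd_divisor N"
  shows
    "(p mod 4 = 1 \<longrightarrow>
        2 * of_nat q * of_nat K / ((of_nat q - 1) * of_nat (totient K)) * of_nat (Z_count q m N (0 :: 'a))
          = of_nat Q - 1 + (- 1) ^ (s * m) * complex_of_real (real q powr (real m / 2))) \<and>
     (p mod 4 = 3 \<longrightarrow>
        2 * of_nat q * of_nat K / ((of_nat q - 1) * of_nat (totient K)) * of_nat (Z_count q m N (0 :: 'a))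
          = of_nat Q - 1 + (- \<i>) ^ (s * m) * complex_of_real (real q powr (real m / 2)))"
proof (cases "p mod 4 = 1 \<or> p mod 4 = 3")
  case True
  interpret trace_extension "TYPE('a)" p s q m
    by (rule trace_extension.intro) (fact assms)+
  have "odd p" using True by presburger
  hence "odd q" using assms(3) by simp
  have "2 dvd gcd Q N" using assms(8,9) by simp
  hence "even Q" by (rule dvd_trans) (rule gcd_dvd1)
  hence "even m"
    unfolding assms(6) by (rule even_degree_of_even_quotient[OF q_ge_2 \<open>odd q\<close>])
  then obtain h where h: "m = 2 * h" by (rule evenE)
  have "h \<ge> 1" using h assms(4) by simp
  define r where "r = q ^ h"
  have r_pow: "r = p ^ (s * h)" by (simp add: r_def assms(3) power_mult)
  have "q ^ 1 \<le> r" unfolding r_def using \<open>h \<ge> 1\<close> q_ge_2 by (intro power_increasing) auto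
  hence qr: "q \<le> r" "r \<ge> 2" using q_ge_2 by simp_all
  define C :: complex where "C = of_nat (Z_count q m 2 (0 :: 'a))"
  define D :: complex where "D = of_nat (Z_count q m N (0 :: 'a))"
  define q' r' :: complex where "q' = of_nat q" and "r' = of_nat r"
  have "q' - 1 \<noteq> 0"
    unfolding q'_def using q_ge_2 by (simp add: of_nat_eq_1_iff)
  have "N > 0" using assms(7) card_finite_field_ge_2[where ?'a = 'a] card_field by (auto intro!: Nat.gr0I)
  hence "odd K" unfolding assms(10) by (rule largest_odd_divisor_decomposition)
  hence "K > 0" by (rule odd_pos)
  have KD: "of_nat K * D = of_nat (totient K) * C"
    using arg_cong[OF N_free_trace_zero_count[OF assms(6-10)], of of_nat] by (simp add: C_def D_def)
  \<comment> \<open>Minus the quadratic Gauss sum of the field, divided by its absolute value \<open>r\<close>.\<close>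
  define \<epsilon> :: complex where "\<epsilon> = (if r mod 4 = 1 then 1 else - 1)"
  have count: "2 * q * Z_count q m 2 (0 :: 'a) = (if r mod 4 = 1 then (r - 1) * (r + q) else (r - q) * (r + 1))"
    using nonsquares_of_trace_zero_even_degree[OF trace_extension_axioms[unfolded h] \<open>odd q\<close> \<open>h \<ge> 1\<close>]
    unfolding r_def h .
  have "2 * q' * C = of_nat (2 * q * Z_count q m 2 (0 :: 'a))"
    by (simp add: C_def q'_def)
  also have "\<dots> = of_nat (if r mod 4 = 1 then (r - 1) * (r + q) else (r - q) * (r + 1))"
    by (simp only: count)
  also have "\<dots> = r' ^ 2 - q' + (q' - 1) * (\<epsilon> * r')"
  proof -
    have "of_nat (r - 1) = r' - 1" "of_nat (r - q) = r' - q'"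
      using qr by (simp_all add: q'_def r'_def of_nat_diff)
    hence "of_nat (if r mod 4 = 1 then (r - 1) * (r + q) else (r - q) * (r + 1))
        = (if r mod 4 = 1 then (r' - 1) * (r' + q') else (r' - q') * (r' + 1))"
      by (simp only: of_nat_mult of_nat_add of_nat_1 if_distrib[of of_nat] flip: q'_def r'_def)
    thus ?thesis by (simp add: \<epsilon>_def power2_eq_square algebra_simps)
  qed
  finally have C: "2 * q' * C = r' ^ 2 - q' + (q' - 1) * (\<epsilon> * r')" .
  have "Q * (q - 1) = q ^ m - 1"
    unfolding assms(6) using geometric_sum_nat[of q m] q_ge_2 by simp
  hence "Q * (q - 1) = r ^ 2 - 1" by (simp add: r_def h mult.commute[of 2] power_mult)
  from arg_cong[OF this, of "of_nat :: nat \<Rightarrow> complex"]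
  have Q: "of_nat Q * (q' - 1) = r' ^ 2 - 1"
    using qr q_ge_2 by (simp add: q'_def r'_def of_nat_diff)
  have main: "2 * q' * of_nat K / ((q' - 1) * of_nat (totient K)) * D = of_nat Q - 1 + \<epsilon> * r'"
  proof -
    have "2 * q' * of_nat K / ((q' - 1) * of_nat (totient K)) * D
        = 2 * q' * (of_nat K * D) / ((q' - 1) * of_nat (totient K))" by simp
    also have "\<dots> = 2 * q' * C / (q' - 1)" unfolding KD using \<open>K > 0\<close> by simp
    also have "2 * q' * C = of_nat Q * (q' - 1) - (q' - 1) + (q' - 1) * (\<epsilon> * r')"
      unfolding C Q by simp
    also have "\<dots> = (of_nat Q - 1 + \<epsilon> * r') * (q' - 1)" by (simp add: algebra_simps)
    finally show ?thesis using \<open>q' - 1 \<noteq> 0\<close> by simp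
  qed
  have "real q powr (real m / 2) = real r"
    using q_ge_2 by (simp add: h r_def powr_realpow)
  hence powr: "complex_of_real (real q powr (real m / 2)) = r'" by (simp add: r'_def)
  have \<epsilon>1: "\<epsilon> = (- 1) ^ (s * m)" if "p mod 4 = 1"
    using mod_4_power(1)[OF that, of "s * h"] by (simp add: \<epsilon>_def r_pow h)
  have \<epsilon>3: "\<epsilon> = (- \<i>) ^ (s * m)" if "p mod 4 = 3"
  proof -
    have "(- \<i>) ^ (s * m) = ((- \<i>) ^ 2) ^ (s * h)"
      unfolding power_mult[symmetric] by (simp add: h mult_ac)
    also have "\<dots> = \<epsilon>"
      using mod_4_power(2)[OF that, of "s * h"] by (simp add: \<epsilon>_def r_pow)
    finally show ?thesis ..
  qed
  show ?thesis
    unfolding powr using main[unfolded D_def q'_def] \<epsilon>1 \<epsilon>3 by simp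
qed auto

end
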